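(* Let $p>3$ be a prime, let $b\in\mathbb Z_p$ with $\langle b\rangle_p\ne0$, and let $s=(b-\langle b\rangle_p)/p$ with $s\not\equiv-1\pmod p$. Then: (i) if $\langle b\rangle_p<p/2$, $$\sum_{k=0}^{p-1}\frac{\binom{2k}k^2}{16^k(k+b)}\equiv\frac{(s+1/2)^2p}{b^2(s+1)\binom{(p-1)/2}{\langle b\rangle_p}^2}\pmod{p^2}\quad\text{and}\quad \sum_{k=0}^{(p-1)/2}\frac{\binom{2k}k^2}{16^k(k+b)}\equiv\frac{b-\langle b\rangle_p}{b^2\binom{(p-1)/2}{\langle b\rangle_p}^2}\pmod{p^2};$$ (ii) if $\langle b\rangle_p<p/3$, $$\sum_{k=0}^{p-1}\frac{\binom{2k}k\binom{3k}k}{27^k(k+b)}\equiv(-1)^{\langle b\rangle_p}\frac{(s+1/3)(s+2/3)p}{b^2(s+1)\binom{2\langle b\rangle_p}{\langle b\rangle_p}\binom{[p/3]+\langle b\rangle_p}{[p/3]-\langle b\rangle_p}}\pmod{p^2};$$ (iii) if $\langle b\rangle_p<p/4$, $$\sum_{k=0}^{p-1}\frac{\binom{2k}k\binom{4k}{2k}}{64^k(k+b)}\equiv(-1)^{\langle b\rangle_p}\frac{(s+1/4)(s+3/4)p}{b^2(s+1)\binom{2\langle b\rangle_p}{\langle b\rangle_p}\binom{[p/4]+\langle b\rangle_p}{[p/4]-\langle b\rangle_p}}\pmod{p^2};$$ (iv) if $\langle b\rangle_p<p/6$, $$\sum_{k=0}^{p-1}\frac{\binom{3k}k\binom{6k}{3k}}{432^k(k+b)}\equiv(-1)^{\langle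 b\rangle_p}\frac{(s+1/6)(s+5/6)p}{b^2(s+1)\binom{2\langle b\rangle_p}{\langle b\rangle_p}\binom{[p/6]+\langle b\rangle_p}{[p/6]-\langle b\rangle_p}}\pmod{p^2}.$$
   Context: $\mathbb Z_p$ denotes the set of rational numbers whose denominator is not divisible by $p$; congruences are taken in this ring. For $b\in\mathbb Z_p$, $\langle b\rangle_p\in\{0,1,\dots,p-1\}$ is defined by $b\equiv\langle b\rangle_p\pmod p$. $[x]$ is the greatest integer not exceeding $x$. *)

theory Defs
  imports Complex_Main "HOL-Number_Theory.Number_Theory"
begin

text \<open>The rationals with denominator (in lowest terms) not divisible by \<open>p\<close>, i.e. the
  localisation of the integers at \<open>p\<close>, not the completion.\<close>
definition Zp :: "nat \<Rightarrow> rat set" where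
  "Zp p = {x. \<not> int p dvd snd (quotient_of x)}"

text \<open>Congruence modulo \<open>m\<close> in the ring \<open>Zp p\<close>. Both sides are required to lie in the ring, so
  that a congruence also asserts \<open>p\<close>-integrality of the expressions involved.\<close>
definition Zp_cong :: "nat \<Rightarrow> nat \<Rightarrow> rat \<Rightarrow> rat \<Rightarrow> bool" where
  "Zp_cong p m x y \<longleftrightarrow> x \<in> Zp p \<and> y \<in> Zp p \<and> (\<exists>z\<in>Zp p. x - y = of_nat m * z)"

definition Zp_res :: "nat \<Rightarrow> rat \<Rightarrow> nat" where
  "Zp_res p b = (THE r. r < p \<and> Zp_cong p p b (of_nat r))"

lemma Zp_iff:
  assumes "prime p"
  shows "x \<in> Zp p \<longleftrightarrow> (\<exists>u v::int. \<not> int p dvd v \<and> x = of_int u / of_int v)"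
proof
  assume "x \<in> Zp p"
  moreover have "x = of_int (fst (quotient_of x)) / of_int (snd (quotient_of x))"
    by (rule quotient_of_div) simp
  ultimately show "\<exists>u v::int. \<not> int p dvd v \<and> x = of_int u / of_int v"
    unfolding Zp_def by blast
next
  assume "\<exists>u v::int. \<not> int p dvd v \<and> x = of_int u / of_int v"
  then obtain u v :: int where v: "\<not> int p dvd v" and x: "x = of_int u / of_int v" by blast
  obtain m n where q: "quotient_of x = (m, n)" by (cases "quotient_of x")
  have n: "n > 0" and cop: "coprime m n"
    using quotient_of_denom_pos[OF q] quotient_of_coprime[OF q] by auto
  have v0: "v \<noteq> 0" using v by auto
  have "x = of_int m / of_int n" by (rule quotient_of_div[OF q])
  then have "(of_int (u * n) :: rat) = of_int (m * v)"
    using x n v0 by (simp add: field_simps)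
  then have "u * n = m * v" by (simp only: of_int_eq_iff)
  then have "n dvd m * v" by (metis dvd_triv_right)
  then have "n dvd v" using cop by (simp add: coprime_dvd_mult_right_iff coprime_commute)
  then show "x \<in> Zp p" using v q by (auto simp: Zp_def dest: dvd_trans)
qed

lemma Zp_res_ex1:
  assumes p: "prime p" and b: "b \<in> Zp p"
  shows "\<exists>!r. r < p \<and> Zp_cong p p b (of_nat r)"
proof -
  have pp: "prime (int p)" using p by simp
  have p0: "p > 0" using p by (simp add: prime_gt_0_nat)
  have int_in: "of_int z \<in> Zp p" for z
    unfolding Zp_iff[OF p] using pp by (intro exI[of _ z] exI[of _ 1]) (auto simp: not_prime_unit)
  then have nat_in: "of_nat r \<in> Zp p" for r by (metis of_int_of_nat_eq)
  obtain u v :: int where v: "\<not> int p dvd v" and bu: "b = of_int u / of_int v"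
    using b unfolding Zp_iff[OF p] by blast
  have v0: "(of_int v :: rat) \<noteq> 0" using v by auto
  have key: "Zp_cong p p b (of_nat r) \<longleftrightarrow> [v * int r = u] (mod int p)" for r
  proof
    assume "Zp_cong p p b (of_nat r)"
    then obtain z where z: "z \<in> Zp p" "b - of_nat r = of_nat p * z" unfolding Zp_cong_def by blast
    obtain c d :: int where d: "\<not> int p dvd d" and zc: "z = of_int c / of_int d"
      using z(1) unfolding Zp_iff[OF p] by blast
    have d0: "(of_int d :: rat) \<noteq> 0" using d by auto
    have "(of_int ((u - v * int r) * d) :: rat) = of_int (int p * (c * v))"
      using z(2) v0 d0 unfolding bu zc by (simp add: field_simps)
    then have "(u - v * int r) * d = int p * (c * v)" by (simp only: of_int_eq_iff)
    then have "int p dvd (u - v * int r) * d" by simp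
    then have "int p dvd u - v * int r" using pp d by (simp add: prime_dvd_mult_iff)
    then show "[v * int r = u] (mod int p)" by (simp add: cong_iff_dvd_diff dvd_diff_commute)
  next
    assume "[v * int r = u] (mod int p)"
    then have "int p dvd u - v * int r" by (simp add: cong_iff_dvd_diff dvd_diff_commute)
    then obtain c where "u - v * int r = int p * c" by blast
    then have "(of_int (u - v * int r) :: rat) = of_int (int p * c)" by simp
    then have "b - of_nat r = of_nat p * (of_int c / of_int v)"
      unfolding bu using v0 by (simp add: field_simps)
    moreover have "of_int c / of_int v \<in> Zp p" using v unfolding Zp_iff[OF p] by blast
    ultimately show "Zp_cong p p b (of_nat r)" unfolding Zp_cong_def using b nat_in by blast
  qed
  have cop: "coprime v (int p)" using pp v by (metis coprime_commute prime_imp_coprime)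
  then obtain w where w: "[v * w = 1] (mod int p)" using cong_solve_coprime_int by blast
  define r where "r = nat ((w * u) mod int p)"
  have ir: "int r = (w * u) mod int p" using p0 by (simp add: r_def)
  have "[v * int r = v * (w * u)] (mod int p)" unfolding ir by (simp add: cong_def mod_mult_right_eq)
  also have "v * (w * u) = (v * w) * u" by (simp add: mult.assoc)
  also have "[(v * w) * u = 1 * u] (mod int p)" using w by (rule cong_scalar_right)
  finally have "[v * int r = u] (mod int p)" by simp
  moreover have "int r < int p" unfolding ir using p0 by simp
  moreover have "r' = r''"
    if "r' < p" "r'' < p" "[v * int r' = u] (mod int p)" "[v * int r'' = u] (mod int p)" for r' r''
  proof -
    have "[v * int r' = v * int r''] (mod int p)" using that(3,4) cong_sym cong_trans by blast
    then have "[int r' = int r''] (mod int p)" using cop by (simp add: cong_mult_lcancel)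
    then show ?thesis using that(1,2) by (simp add: cong_def)
  qed
  ultimately show ?thesis unfolding key by (intro ex1I[of _ r]) auto
qed

end

theory Submission
  imports Defs
begin

text \<open>
  All four families have the form $c_k = \binom{a}{k}\binom{-1-a}{k}$ with
  $a = -1/2, -1/3, -1/4, -1/6$, so that $(k+1)^2 c_{k+1} = (k^2+k+w) c_k$ with $w = -a(a+1) = c_1$.
  For $S(b) = \sum_{k<N} c_k/(k+b)$ this telescopes to
  $(w+b+b^2) S(b+1) = b^2 S(b) + N^2 c_N/(N+b)$. Since $(ps)^2 S(ps) \equiv ps$ modulo $p^2$, the
  recurrence can be started at $b = ps$ and climbed $r = \langle b\rangle_p$ steps. For $N = p$ the
  boundary term contributes only in the first step, where $c_p \equiv w$ modulo $p$ turns $s$ into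
  $(s-a)(s+a+1)/(s+1)$; for $N = (p+1)/2$ it vanishes because $p^2$ divides $c_N$. The factors
  $w+j+j^2 \equiv -(n-j)(n+1+j)$, with $n = [p/m]$ and $a = -1/m$, multiply up to the binomial
  coefficients of the statement.
\<close>

section \<open>Telescoping in the shift \<open>b\<close>\<close>

text \<open>Put \<open>G k = k^2 * c k / (k + b)\<close>. By \<open>rec\<close>, the k-th summands
  of the two weighted sums differ by \<open>G (k + 1) - G k\<close>, and \<open>G 0 = 0\<close>, so
  only \<open>G N\<close> survives. The value \<open>b = 0\<close>, which arises for
  \<open>s = 0\<close>, is covered by \<open>c 0 / 0 = 0\<close>.\<close>

lemma sum_shift_recurrence:
  fixes c :: "nat \<Rightarrow> 'a :: field"
  assumes rec: "\<And>k. (of_nat k + 1) ^ 2 * c (Suc k) = (of_nat k ^ 2 + of_nat k + w) * c k"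
    and nz: "\<And>k. 1 \<le> k \<Longrightarrow> k \<le> N \<Longrightarrow> of_nat k + b \<noteq> 0"
  shows "(w + b + b ^ 2) * (\<Sum>k<N. c k / (of_nat k + (b + 1))) =
    b ^ 2 * (\<Sum>k<N. c k / (of_nat k + b)) + of_nat N ^ 2 * c N / (of_nat N + b)"
  using nz
proof (induction N)
  case (Suc N)
  have nz': "of_nat N + (b + 1) \<noteq> 0" using Suc.prems[of "Suc N"] by (simp add: algebra_simps)
  have 1: "of_nat (Suc N) ^ 2 * c (Suc N) = (of_nat N ^ 2 + of_nat N + w) * c N"
    using rec[of N] by (simp add: algebra_simps)
  have "b ^ 2 / (of_nat N + b) - of_nat N ^ 2 / (of_nat N + b) = b - of_nat N"
  proof (cases "of_nat N + b = 0")
    case True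
    \<comment> \<open>Here \<open>b = -N\<close>, and \<open>nz\<close> leaves only
      \<open>N = 0\<close>, where division by zero makes both sides vanish.\<close>
    then have "N = 0" using Suc.prems[of N] by force
    then show ?thesis using True by simp
  next
    case False
    have "b ^ 2 - of_nat N ^ 2 = (b - of_nat N) * (of_nat N + b)"
      by (simp add: algebra_simps power2_eq_square)
    then show ?thesis using False by (simp flip: diff_divide_distrib)
  qed
  then have "b ^ 2 / (of_nat N + b) = (b - of_nat N) + of_nat N ^ 2 / (of_nat N + b)"
    by (simp add: diff_eq_eq)
  then have "b ^ 2 / (of_nat N + b) * c N = ((b - of_nat N) + of_nat N ^ 2 / (of_nat N + b)) * c N"
    by simp
  then have "b ^ 2 * (c N / (of_nat N + b)) =
      (b - of_nat N) * c N + of_nat N ^ 2 * c N / (of_nat N + b)"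
    by (simp add: distrib_right)
  \<comment> \<open>This is \<open>w + b + b^2 = (b - N) * (N + b + 1) + (N^2 + N + w)\<close>
    divided by \<open>N + b + 1\<close>; the same \<open>(b - N) * c N\<close> occurs in the
    preceding equation.\<close>
  moreover have "(w + b + b ^ 2) * (c N / (of_nat N + (b + 1))) =
      (b - of_nat N) * c N + of_nat (Suc N) ^ 2 * c (Suc N) / (of_nat (Suc N) + b)"
    unfolding 1 using nz' by (simp add: field_simps power2_eq_square)
  moreover have "(w + b + b ^ 2) * (\<Sum>k<N. c k / (of_nat k + (b + 1))) =
      b ^ 2 * (\<Sum>k<N. c k / (of_nat k + b)) + of_nat N ^ 2 * c N / (of_nat N + b)"
    by (rule Suc.IH) (use Suc.prems in simp)
  ultimately show ?case by (simp only: sum.lessThan_Suc distrib_left add_ac)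
qed simp

section \<open>Binomial coefficients modulo a prime\<close>

text \<open>Splitting \<open>p\<close> off the upper index by Vandermonde leaves only
  \<open>k = 0\<close> and \<open>k = p\<close>, because \<open>p\<close> divides
  \<open>p choose k\<close> in between. The two survivors form Pascal's rule for \<open>m\<close>
  and \<open>j\<close>.\<close>

lemma choose_prime_mult_cong:
  assumes "prime p"
  shows "[(m * p) choose (j * p) = m choose j] (mod p)"
proof (induction m arbitrary: j)
  case 0
  have "p > 0" using assms by (simp add: prime_gt_0_nat)
  then show ?case by (cases j) (simp_all add: binomial_eq_0)
next
  case (Suc m)
  show ?case
  proof (cases j)
    case (Suc i)
    have p: "p > 0" using assms by (simp add: prime_gt_0_nat)
    have "(Suc m * p) choose (j * p) = (p + m * p) choose (j * p)" by simp
    also have "\<dots> = (\<Sum>k\<le>j * p. (p choose k) * ((m * p) choose (j * p - k)))"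
      by (rule vandermonde[symmetric])
    also have "[\<dots> = (\<Sum>k\<le>j * p. if k \<in> {0, p} then (m * p) choose (j * p - k) else 0)] (mod p)"
    proof (rule cong_sum)
      fix k
      show "[(p choose k) * ((m * p) choose (j * p - k)) =
          (if k \<in> {0, p} then (m * p) choose (j * p - k) else 0)] (mod p)"
      proof (cases "k \<in> {0, p}")
        case False
        have "p dvd p choose k"
        proof (cases "k < p")
          case True
          then show ?thesis using False assms by (intro dvd_choose_prime) auto
        qed (use False in \<open>simp add: binomial_eq_0\<close>)
        then show ?thesis using False by (simp add: cong_0_iff)
      qed auto
    qed
    \<comment> \<open>\<open>j = Suc i\<close> gives \<open>p \<le> j * p\<close>, so both surviving
      indices are in range.\<close>
    also have "(\<Sum>k\<le>j * p. if k \<in> {0, p} then (m * p) choose (j * p - k) else 0) =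
        (\<Sum>k\<in>{0, p}. (m * p) choose (j * p - k))"
      using Suc by (subst sum.inter_restrict[symmetric]) (auto intro!: sum.cong)
    also have "\<dots> = ((m * p) choose (j * p)) + ((m * p) choose (i * p))"
      using p Suc by simp
    also have "[\<dots> = (m choose j) + (m choose i)] (mod p)"
      by (intro cong_add Suc.IH)
    finally show ?thesis using Suc by (simp add: add.commute)
  qed simp
qed

section \<open>Recurrences of the four coefficient families\<close>

lemma fact_mult_Suc:
  fixes k :: nat
  defines "x \<equiv> of_nat k :: 'a :: field_char_0"
  shows "fact (2 * Suc k) = (2 * x + 2) * (2 * x + 1) * (fact (2 * k) :: 'a)"
    and "fact (3 * Suc k) = (3 * x + 3) * (3 * x + 2) * (3 * x + 1) * (fact (3 * k) :: 'a)"
    and "fact (4 * Suc k) = (4 * x + 4) * (4 * x + 3) * (4 * x + 2) * (4 * x + 1) * (fact (4 * k) :: 'a)"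
    and "fact (6 * Suc k) =
      (6 * x + 6) * (6 * x + 5) * (6 * x + 4) * (6 * x + 3) * (6 * x + 2) * (6 * x + 1) *
      (fact (6 * k) :: 'a)"
  unfolding x_def by (simp_all add: eval_nat_numeral algebra_simps)

text \<open>The ratio \<open>c (k + 1) / c k\<close> is \<open>(k + 1/2)^2 / (k + 1)^2\<close>; the
  base 16 makes its leading coefficients agree.\<close>

lemma choose_2_choose_2_recurrence:
  fixes c :: "nat \<Rightarrow> rat"
  assumes c: "\<And>k. c k = of_nat ((2 * k) choose k) ^ 2 / 16 ^ k"
  shows "(of_nat k + 1) ^ 2 * c (Suc k) = (of_nat k ^ 2 + of_nat k + 1 / 4) * c k"
proof -
  let ?x = "of_nat k :: rat"
  let ?num = "((2 * ?x + 2) * (2 * ?x + 1)) ^ 2"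
  let ?den = "(?x + 1) ^ 4 * 16"
  \<comment> \<open>In factorial form a shift of \<open>k\<close> multiplies by explicit linear
    factors, so the ratio \<open>?num / ?den\<close> can be read off.\<close>
  have c_eq: "c k = fact (2 * k) ^ 2 / (fact k ^ 4 * 16 ^ k)" for k
  proof -
    have "2 * k - k = k" by simp_all
    then show ?thesis
      unfolding c by (simp add: binomial_fact power2_eq_square eval_nat_numeral power_divide)
  qed
  have fact_1: "fact (Suc k) = (?x + 1) * fact k" by simp
  have "c (Suc k) = ?num / ?den * c k"
    unfolding c_eq fact_mult_Suc fact_1 power_Suc2 power_mult_distrib by simp
  moreover have "?x + 1 \<noteq> 0" "2 * ?x + 1 \<noteq> 0" "3 * ?x + 1 \<noteq> 0" "3 * ?x + 2 \<noteq> 0"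
    using of_nat_0_le_iff[of k, where 'a = rat] by linarith+
  then have "(?x + 1) ^ 2 * (?num / ?den) = ?x ^ 2 + ?x + 1 / 4"
    by (simp add: divide_simps) (simp add: algebra_simps eval_nat_numeral)
  ultimately show ?thesis by (simp only: mult.assoc [symmetric])
qed

text \<open>Here the ratio of consecutive terms is
  \<open>(k + 1/3) * (k + 2/3) / (k + 1)^2\<close>.\<close>

lemma choose_2_choose_3_recurrence:
  fixes c :: "nat \<Rightarrow> rat"
  assumes c: "\<And>k. c k = of_nat ((2 * k) choose k) * of_nat ((3 * k) choose k) / 27 ^ k"
  shows "(of_nat k + 1) ^ 2 * c (Suc k) = (of_nat k ^ 2 + of_nat k + 2 / 9) * c k"
proof -
  let ?x = "of_nat k :: rat"
  let ?num = "(3 * ?x + 3) * (3 * ?x + 2) * (3 * ?x + 1)"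
  let ?den = "(?x + 1) ^ 3 * 27"
  have c_eq: "c k = fact (3 * k) / (fact k ^ 3 * 27 ^ k)" for k
  proof -
    have "2 * k - k = k" "3 * k - k = 2 * k" by simp_all
    then show ?thesis
      unfolding c by (simp add: binomial_fact power2_eq_square eval_nat_numeral power_divide)
  qed
  have fact_1: "fact (Suc k) = (?x + 1) * fact k" by simp
  have "c (Suc k) = ?num / ?den * c k"
    unfolding c_eq fact_mult_Suc fact_1 power_Suc2 power_mult_distrib by simp
  moreover have "?x + 1 \<noteq> 0" "2 * ?x + 1 \<noteq> 0" "3 * ?x + 1 \<noteq> 0" "3 * ?x + 2 \<noteq> 0"
    using of_nat_0_le_iff[of k, where 'a = rat] by linarith+
  then have "(?x + 1) ^ 2 * (?num / ?den) = ?x ^ 2 + ?x + 2 / 9"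
    by (simp add: divide_simps) (simp add: algebra_simps eval_nat_numeral)
  ultimately show ?thesis by (simp only: mult.assoc [symmetric])
qed

text \<open>The factors \<open>4k + 4\<close> and \<open>4k + 2\<close> cancel against those of
  \<open>fact (2 * k)\<close> up to a constant, which leaves the ratio
  \<open>(k + 1/4) * (k + 3/4) / (k + 1)^2\<close>.\<close>

lemma choose_2_choose_4_recurrence:
  fixes c :: "nat \<Rightarrow> rat"
  assumes c: "\<And>k. c k = of_nat ((2 * k) choose k) * of_nat ((4 * k) choose (2 * k)) / 64 ^ k"
  shows "(of_nat k + 1) ^ 2 * c (Suc k) = (of_nat k ^ 2 + of_nat k + 3 / 16) * c k"
proof -
  let ?x = "of_nat k :: rat"
  let ?num = "(4 * ?x + 4) * (4 * ?x + 3) * (4 * ?x + 2) * (4 * ?x + 1)"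
  let ?den = "(?x + 1) ^ 2 * ((2 * ?x + 2) * (2 * ?x + 1)) * 64"
  have c_eq: "c k = fact (4 * k) / (fact k ^ 2 * fact (2 * k) * 64 ^ k)" for k
  proof -
    have "2 * k - k = k" "4 * k - 2 * k = 2 * k" by simp_all
    then show ?thesis
      unfolding c by (simp add: binomial_fact power2_eq_square eval_nat_numeral power_divide)
  qed
  have fact_1: "fact (Suc k) = (?x + 1) * fact k" by simp
  have "c (Suc k) = ?num / ?den * c k"
    unfolding c_eq fact_mult_Suc fact_1 power_Suc2 power_mult_distrib by simp
  moreover have "?x + 1 \<noteq> 0" "2 * ?x + 1 \<noteq> 0" "3 * ?x + 1 \<noteq> 0" "3 * ?x + 2 \<noteq> 0"
    using of_nat_0_le_iff[of k, where 'a = rat] by linarith+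
  then have "(?x + 1) ^ 2 * (?num / ?den) = ?x ^ 2 + ?x + 3 / 16"
    by (simp add: divide_simps) (simp add: algebra_simps eval_nat_numeral)
  ultimately show ?thesis by (simp only: mult.assoc [symmetric])
qed

text \<open>The even factors and \<open>6k + 3\<close> cancel down to constants and
  \<open>(k + 1)^2\<close> in the denominator; the ratio is
  \<open>(k + 1/6) * (k + 5/6) / (k + 1)^2\<close>.\<close>

lemma choose_3_choose_6_recurrence:
  fixes c :: "nat \<Rightarrow> rat"
  assumes c: "\<And>k. c k = of_nat ((3 * k) choose k) * of_nat ((6 * k) choose (3 * k)) / 432 ^ k"
  shows "(of_nat k + 1) ^ 2 * c (Suc k) = (of_nat k ^ 2 + of_nat k + 5 / 36) * c k"
proof -
  let ?x = "of_nat k :: rat"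
  let ?num = "(6 * ?x + 6) * (6 * ?x + 5) * (6 * ?x + 4) * (6 * ?x + 3) * (6 * ?x + 2) * (6 * ?x + 1)"
  let ?den = "(?x + 1) * ((2 * ?x + 2) * (2 * ?x + 1)) * ((3 * ?x + 3) * (3 * ?x + 2) * (3 * ?x + 1)) * 432"
  have c_eq: "c k = fact (6 * k) / (fact k * fact (2 * k) * fact (3 * k) * 432 ^ k)" for k
  proof -
    have "3 * k - k = 2 * k" "6 * k - 3 * k = 3 * k" by simp_all
    then show ?thesis
      unfolding c by (simp add: binomial_fact power2_eq_square eval_nat_numeral power_divide)
  qed
  have fact_1: "fact (Suc k) = (?x + 1) * fact k" by simp
  have "c (Suc k) = ?num / ?den * c k"
    unfolding c_eq fact_mult_Suc fact_1 power_Suc2 power_mult_distrib by simp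
  moreover have "?x + 1 \<noteq> 0" "2 * ?x + 1 \<noteq> 0" "3 * ?x + 1 \<noteq> 0" "3 * ?x + 2 \<noteq> 0"
    using of_nat_0_le_iff[of k, where 'a = rat] by linarith+
  then have "(?x + 1) ^ 2 * (?num / ?den) = ?x ^ 2 + ?x + 5 / 36"
    by (simp add: divide_simps) (simp add: algebra_simps eval_nat_numeral)
  ultimately show ?thesis by (simp only: mult.assoc [symmetric])
qed

section \<open>Products as factorials and binomials\<close>

lemma prod_diff_eq_fact_ratio:
  "i \<le> n \<Longrightarrow> (\<Prod>j<i. of_nat (n - j)) = (fact n / fact (n - i) :: 'a :: field_char_0)"
proof (induction i)
  case (Suc i)
  then have "n - i = Suc (n - Suc i)" by simp
  then have "(fact (n - i) :: 'a) = of_nat (n - i) * fact (n - Suc i)"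
    using fact_Suc[of "n - Suc i", where 'a = 'a] by simp
  moreover have "(of_nat (n - i) :: 'a) \<noteq> 0" using Suc.prems by simp
  ultimately show ?case using Suc by simp
qed simp

text \<open>The products are the squares of \<open>r!\<close> and of the falling factorial
  \<open>n! / (n - r)!\<close>. The spectator factor \<open>x\<close> will be
  \<open>b ^ 2\<close>.\<close>

lemma prod_sq_eq_choose_sq:
  assumes "r \<le> n"
  shows "(\<Prod>j=1..r. of_nat j ^ 2) / (x * (\<Prod>j<r. of_nat (n - j) ^ 2)) =
    1 / (x * of_nat (n choose r) ^ 2 :: 'a :: field_char_0)"
proof -
  have "(\<Prod>j=1..r. (of_nat j :: 'a) ^ 2) = fact r ^ 2"
    by (simp add: prod_power_distrib fact_prod)
  moreover have "(\<Prod>j<r. (of_nat (n - j) :: 'a) ^ 2) = (fact n / fact (n - r)) ^ 2"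
    by (simp only: prod_power_distrib[symmetric] prod_diff_eq_fact_ratio[OF assms])
  ultimately show ?thesis
    using assms by (simp add: binomial_fact power_divide power_mult_distrib mult_ac del: of_nat_diff)
qed

section \<open>Arithmetic and units of the localisation at \<open>p\<close>\<close>

locale prime_localization =
  fixes p :: nat
  assumes prime_p: "prime p"
begin

lemma Zp_of_int [simp]: "of_int z \<in> Zp p"
  unfolding Zp_iff[OF prime_p] using prime_p
  by (intro exI[of _ z] exI[of _ 1]) (auto simp: not_prime_unit)

lemma Zp_of_nat [simp]: "of_nat n \<in> Zp p"
  using Zp_of_int[of "int n"] by simp

lemma Zp_numeral [simp]: "0 \<in> Zp p" "1 \<in> Zp p" "numeral m \<in> Zp p"
  using Zp_of_int[of 0] Zp_of_int[of 1] Zp_of_int[of "numeral m"] by simp_all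

lemma Zp_add [simp]:
  assumes "x \<in> Zp p" "y \<in> Zp p"
  shows "x + y \<in> Zp p"
proof -
  obtain u v u' v' :: int where *: "\<not> int p dvd v" "x = of_int u / of_int v"
      "\<not> int p dvd v'" "y = of_int u' / of_int v'"
    using assms unfolding Zp_iff[OF prime_p] by blast
  have "v \<noteq> 0" "v' \<noteq> 0" using * by auto
  then have "x + y = of_int (u * v' + u' * v) / of_int (v * v')"
    using * by (simp add: field_simps)
  moreover have "\<not> int p dvd v * v'"
    using * prime_p by (simp add: prime_dvd_mult_iff)
  ultimately show ?thesis unfolding Zp_iff[OF prime_p] by blast
qed

lemma Zp_mult [simp]:
  assumes "x \<in> Zp p" "y \<in> Zp p"
  shows "x * y \<in> Zp p"
proof -
  obtain u v u' v' :: int where *: "\<not> int p dvd v" "x = of_int u / of_int v"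
      "\<not> int p dvd v'" "y = of_int u' / of_int v'"
    using assms unfolding Zp_iff[OF prime_p] by blast
  have "x * y = of_int (u * u') / of_int (v * v')"
    using * by simp
  moreover have "\<not> int p dvd v * v'"
    using * prime_p by (simp add: prime_dvd_mult_iff)
  ultimately show ?thesis unfolding Zp_iff[OF prime_p] by blast
qed

lemma Zp_uminus [simp]: "x \<in> Zp p \<Longrightarrow> - x \<in> Zp p"
  using Zp_mult[OF Zp_of_int[of "-1"]] by simp

lemma Zp_diff [simp]: "x \<in> Zp p \<Longrightarrow> y \<in> Zp p \<Longrightarrow> x - y \<in> Zp p"
  using Zp_add[of x "- y"] by simp

lemma Zp_power [simp]: "x \<in> Zp p \<Longrightarrow> x ^ n \<in> Zp p"
  by (induction n) auto

lemma Zp_sum: "(\<And>k. k \<in> A \<Longrightarrow> f k \<in> Zp p) \<Longrightarrow> sum f A \<in> Zp p"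
  by (induction A rule: infinite_finite_induct) auto

text \<open>Since \<open>inverse 0 = 0\<close> lies in \<open>Zp p\<close>, the condition
  \<open>x \<noteq> 0\<close> is what keeps 0 from counting as a unit.\<close>

definition Zp_units :: "rat set" where
  "Zp_units = {x \<in> Zp p. x \<noteq> 0 \<and> inverse x \<in> Zp p}"

lemma Zp_units_Zp: "x \<in> Zp_units \<Longrightarrow> x \<in> Zp p"
  by (simp add: Zp_units_def)

lemma Zp_units_nonzero: "x \<in> Zp_units \<Longrightarrow> x \<noteq> 0"
  by (simp add: Zp_units_def)

lemma Zp_divide [simp]: "x \<in> Zp p \<Longrightarrow> y \<in> Zp_units \<Longrightarrow> x / y \<in> Zp p"
  by (simp add: Zp_units_def divide_inverse)

lemma Zp_units_mult: "x \<in> Zp_units \<Longrightarrow> y \<in> Zp_units \<Longrightarrow> x * y \<in> Zp_units"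
  by (simp add: Zp_units_def)

lemma Zp_units_uminus: "x \<in> Zp_units \<Longrightarrow> - x \<in> Zp_units"
  by (simp add: Zp_units_def)

lemma Zp_units_power: "x \<in> Zp_units \<Longrightarrow> x ^ n \<in> Zp_units"
  by (simp add: Zp_units_def flip: power_inverse)

lemma Zp_units_1: "1 \<in> Zp_units"
  by (simp add: Zp_units_def)

lemma Zp_units_prod: "(\<And>k. k \<in> A \<Longrightarrow> f k \<in> Zp_units) \<Longrightarrow> prod f A \<in> Zp_units"
  by (induction A rule: infinite_finite_induct)
     (auto intro: Zp_units_mult simp: Zp_units_1)

lemma Zp_units_of_nat: "\<not> p dvd n \<Longrightarrow> of_nat n \<in> Zp_units"
proof -
  assume n: "\<not> p dvd n"
  have "inverse (of_nat n) = (of_int 1 / of_int (int n) :: rat)" by (simp add: divide_inverse)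
  moreover have "\<not> int p dvd int n" using n by simp
  ultimately have "inverse (of_nat n) \<in> Zp p" unfolding Zp_iff[OF prime_p] by blast
  moreover have "n \<noteq> 0" using n by (intro notI) simp
  ultimately show ?thesis by (simp add: Zp_units_def)
qed

lemma p_nonzero: "(of_nat p :: rat) \<noteq> 0"
  using prime_p by auto

text \<open>\<open>1 / p = u / v\<close> would give \<open>v = p * u\<close>. This is the source of
  the contradiction in \<open>Zp_cong_unit\<close>.\<close>

lemma inverse_p_notin_Zp: "inverse (of_nat p) \<notin> Zp p"
proof
  assume "inverse (of_nat p) \<in> Zp p"
  then obtain u v :: int where *: "\<not> int p dvd v" "inverse (of_nat p) = (of_int u / of_int v :: rat)"
    unfolding Zp_iff[OF prime_p] by blast
  have "v \<noteq> 0" using * by auto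
  then have "of_int v = (of_int (int p * u) :: rat)" using * p_nonzero by (simp add: field_simps)
  then have "v = int p * u" by (simp only: of_int_eq_iff)
  then show False using * by simp
qed

text \<open>The ring is local: \<open>u / v\<close> with \<open>u\<close> and \<open>v\<close> prime
  to \<open>p\<close> is inverted by \<open>v / u\<close>, so \<open>p\<close> divides the numerator
  of a nonunit.\<close>

lemma nonunit_Zp_cong_0:
  assumes "x \<in> Zp p" "x \<notin> Zp_units"
  shows "Zp_cong p p x 0"
proof -
  obtain u v :: int where *: "\<not> int p dvd v" "x = of_int u / of_int v"
    using assms unfolding Zp_iff[OF prime_p] by blast
  have "int p dvd u"
  proof (rule ccontr)
    assume u: "\<not> int p dvd u"
    then have "inverse x \<in> Zp p" unfolding Zp_iff[OF prime_p] using *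
      by (intro exI[of _ v] exI[of _ u]) auto
    moreover have "x \<noteq> 0" using u * by auto
    ultimately show False using assms by (simp add: Zp_units_def)
  qed
  then obtain w where "u = int p * w" by blast
  then have "x - 0 = of_nat p * (of_int w / of_int v)" using * by simp
  moreover have "of_int w / of_int v \<in> Zp p" unfolding Zp_iff[OF prime_p] using * by blast
  ultimately show ?thesis using assms Zp_numeral(1) unfolding Zp_cong_def by blast
qed

lemma Zp_cong_refl: "x \<in> Zp p \<Longrightarrow> Zp_cong p m x x"
  unfolding Zp_cong_def by (auto intro!: bexI[of _ 0])

lemma Zp_cong_sym: "Zp_cong p m x y \<Longrightarrow> Zp_cong p m y x"
proof -
  assume *: "Zp_cong p m x y"
  then obtain z where "z \<in> Zp p" "x - y = of_nat m * z" unfolding Zp_cong_def by blast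
  then have "- z \<in> Zp p" "y - x = of_nat m * (- z)" by (simp_all add: algebra_simps)
  then show ?thesis using * unfolding Zp_cong_def by blast
qed

lemma Zp_cong_trans [trans]:
  assumes "Zp_cong p m x y" "Zp_cong p m y z"
  shows "Zp_cong p m x z"
proof -
  obtain u v where *: "u \<in> Zp p" "v \<in> Zp p" "x - y = of_nat m * u" "y - z = of_nat m * v"
    using assms unfolding Zp_cong_def by blast
  then have "x - z = of_nat m * (u + v)" by (simp add: algebra_simps)
  then show ?thesis using assms * unfolding Zp_cong_def by (blast intro: Zp_add)
qed

lemma Zp_cong_add:
  assumes "Zp_cong p m x y" "Zp_cong p m x' y'"
  shows "Zp_cong p m (x + x') (y + y')"
proof -
  obtain u v where *: "u \<in> Zp p" "v \<in> Zp p" "x - y = of_nat m * u" "x' - y' = of_nat m * v"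
    using assms unfolding Zp_cong_def by blast
  then have "(x + x') - (y + y') = of_nat m * (u + v)" by (simp add: algebra_simps)
  then show ?thesis using assms * unfolding Zp_cong_def by (blast intro: Zp_add)
qed

lemma Zp_cong_mult:
  assumes "Zp_cong p m x y" "Zp_cong p m x' y'"
  shows "Zp_cong p m (x * x') (y * y')"
proof -
  obtain u v where *: "u \<in> Zp p" "v \<in> Zp p" "x - y = of_nat m * u" "x' - y' = of_nat m * v"
    using assms unfolding Zp_cong_def by blast
  have "x * x' - y * y' = (x - y) * x' + y * (x' - y')" by (simp add: algebra_simps)
  also have "\<dots> = of_nat m * (u * x' + y * v)" using * by (simp add: algebra_simps)
  finally show ?thesis using assms * unfolding Zp_cong_def by (blast intro: Zp_add Zp_mult)
qed

lemma Zp_cong_power: "Zp_cong p m x y \<Longrightarrow> Zp_cong p m (x ^ n) (y ^ n)"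
  by (induction n) (auto intro: Zp_cong_mult Zp_cong_refl)

lemma Zp_cong_divide:
  assumes "Zp_cong p m x y" "Zp_cong p m x' y'" "x' \<in> Zp_units" "y' \<in> Zp_units"
  shows "Zp_cong p m (x / x') (y / y')"
proof -
  obtain u v where *: "u \<in> Zp p" "v \<in> Zp p" "x - y = of_nat m * u" "x' - y' = of_nat m * v"
    using assms unfolding Zp_cong_def by blast
  have nz: "x' \<noteq> 0" "y' \<noteq> 0" using assms by (auto simp: Zp_units_nonzero)
  have "x / x' - y / y' = ((x - y) * y' - y * (x' - y')) / (x' * y')"
    using nz by (simp add: field_simps)
  also have "\<dots> = of_nat m * ((u * y' - y * v) / (x' * y'))" unfolding * by (simp add: algebra_simps)
  finally have "x / x' - y / y' = of_nat m * ((u * y' - y * v) / (x' * y'))" .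
  moreover have "(u * y' - y * v) / (x' * y') \<in> Zp p"
    using assms * by (auto simp: Zp_cong_def Zp_units_mult)
  moreover have "x / x' \<in> Zp p" "y / y' \<in> Zp p" using assms by (auto simp: Zp_cong_def)
  ultimately show ?thesis unfolding Zp_cong_def by blast
qed

text \<open>If \<open>x\<close> were a nonunit, then \<open>y = p * z\<close> with \<open>z\<close>
  in the ring, and \<open>z / y\<close> would be an inverse of \<open>p\<close> there.\<close>

lemma Zp_cong_unit:
  assumes "Zp_cong p p x y" "y \<in> Zp_units"
  shows "x \<in> Zp_units"
proof (rule ccontr)
  assume "x \<notin> Zp_units"
  then have "Zp_cong p p x 0" using assms nonunit_Zp_cong_0 by (auto simp: Zp_cong_def)
  then have "Zp_cong p p y 0" using assms Zp_cong_sym Zp_cong_trans by blast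
  then obtain z where z: "z \<in> Zp p" "y = of_nat p * z" by (auto simp: Zp_cong_def)
  then have "inverse (of_nat p) = z * inverse y"
    using Zp_units_nonzero[OF assms(2)] p_nonzero by (simp add: field_simps)
  then show False using inverse_p_notin_Zp Zp_mult[OF z(1)] assms(2)
    unfolding Zp_units_def by force
qed

lemma Zp_cong_of_nat:
  assumes "[m = n] (mod p)"
  shows "Zp_cong p p (of_nat m) (of_nat n)"
proof -
  have "[int m = int n] (mod int p)" using assms by (simp add: cong_int_iff)
  then obtain k where "int m - int n = int p * k" by (auto simp: cong_iff_dvd_diff)
  then have "(of_int (int m - int n) :: rat) = of_int (int p * k)" by (simp only:)
  then have "(of_nat m - of_nat n :: rat) = of_nat p * of_int k" by simp
  then show ?thesis unfolding Zp_cong_def by (auto intro: bexI[of _ "of_int k"])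
qed

lemma Zp_cong_p_add: "x \<in> Zp p \<Longrightarrow> y \<in> Zp p \<Longrightarrow> Zp_cong p p (of_nat p * x + y) y"
  by (auto simp: Zp_cong_def)

text \<open>Once a factor \<open>p\<close> is split off, work modulo \<open>p\<close> gives results
  modulo \<open>p ^ 2\<close>; all sums below are treated this way.\<close>

lemma Zp_cong_p_mult: "Zp_cong p p x y \<Longrightarrow> Zp_cong p (p ^ 2) (of_nat p * x) (of_nat p * y)"
proof -
  assume *: "Zp_cong p p x y"
  then obtain z where "z \<in> Zp p" "x - y = of_nat p * z" unfolding Zp_cong_def by blast
  moreover from this have "of_nat p * x - of_nat p * y = of_nat (p ^ 2) * z"
    by (simp add: power2_eq_square flip: right_diff_distrib)
  ultimately show ?thesis using * unfolding Zp_cong_def by auto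
qed

lemma Zp_units_of_p_mult_add:
  assumes "s \<in> Zp p" "\<not> p dvd k"
  shows "of_nat k + of_nat p * s \<in> Zp_units"
  using Zp_cong_unit[OF Zp_cong_p_add[OF assms(1) Zp_of_nat] Zp_units_of_nat[OF assms(2)]]
  by (subst add.commute)

section \<open>Climbing from \<open>p * s\<close> to \<open>b\<close>\<close>

text \<open>One climb serves both truncations. \<open>v j\<close> is a unit standing for
  \<open>w + j + j^2\<close> modulo \<open>p\<close>, \<open>e j\<close> is the boundary term of
  step \<open>j\<close> divided by \<open>p\<close>, and \<open>Q\<close> is the residue of
  \<open>s + e 0\<close> left by the first step. Later steps have \<open>e j\<close> vanishing
  modulo \<open>p\<close>, so each only multiplies by \<open>j^2 / v j\<close>.\<close>

lemma truncated_sum_cong: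
  fixes c v e :: "nat \<Rightarrow> rat" and w s Q :: rat
  assumes s: "s \<in> Zp p" "s + 1 \<in> Zp_units"
    and N: "0 < N" "N \<le> p"
    and r: "0 < r" "r < p" and b: "b = of_nat p * s + of_nat r"
    and c: "c 0 = 1" "\<And>k. c k \<in> Zp p"
    and rec: "\<And>k. (of_nat k + 1) ^ 2 * c (Suc k) = (of_nat k ^ 2 + of_nat k + w) * c k"
    and v: "\<And>j. j < r \<Longrightarrow> v j \<in> Zp_units"
      "\<And>j. j < r \<Longrightarrow> Zp_cong p p (w + of_nat j + of_nat j ^ 2) (v j)"
    and e: "\<And>j. j < r \<Longrightarrow>
        of_nat N ^ 2 * c N / (of_nat N + (of_nat p * s + of_nat j)) = of_nat p * e j"
      "\<And>j. 0 < j \<Longrightarrow> j < r \<Longrightarrow> Zp_cong p p (e j) 0"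
      "Zp_cong p p (s + e 0) Q"
  shows "Zp_cong p (p ^ 2) (\<Sum>k<N. c k / (of_nat k + b))
    (of_nat p * (Q * (\<Prod>j=1..r. of_nat j ^ 2) / (b ^ 2 * (\<Prod>j<r. v j))))"
proof -
  define \<beta> where "\<beta> j = of_nat p * s + of_nat j" for j
  define S where "S x = (\<Sum>k<N. c k / (of_nat k + x))" for x
  define u where "u j = w + \<beta> j + \<beta> j ^ 2" for j
  have Zp_\<beta>: "\<beta> j \<in> Zp p" for j using s by (simp add: \<beta>_def)
  have \<beta>_cong: "Zp_cong p p (\<beta> j) (of_nat j)" for j
    unfolding \<beta>_def using s by (simp add: Zp_cong_p_add)
  have w: "w \<in> Zp p" using v(2)[of 0] r by (simp add: Zp_cong_def)
  have u_cong: "Zp_cong p p (u j) (v j)" if "j < r" for j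
    unfolding u_def using v(2)[OF that] w
    by (blast intro: Zp_cong_trans Zp_cong_add Zp_cong_power Zp_cong_refl \<beta>_cong)
  then have u_unit: "u j \<in> Zp_units" if "j < r" for j using Zp_cong_unit v(1) that by blast
  have Q: "Q \<in> Zp p" using e(3) by (simp add: Zp_cong_def)
  have step: "u j * S (\<beta> (Suc j)) = \<beta> j ^ 2 * S (\<beta> j) + of_nat p * e j" if j: "j < r" for j
  proof -
    \<comment> \<open>For \<open>k + j = p\<close> the value is \<open>p * (s + 1)\<close>, nonzero
      because \<open>s + 1\<close> is a unit. Otherwise \<open>0 < k + j < 2 * p\<close> makes
      \<open>k + j\<close> prime to \<open>p\<close>, and \<open>k + \<beta> j\<close> is itself a
      unit.\<close>
    have "of_nat k + \<beta> j \<noteq> 0" if k: "1 \<le> k" "k \<le> N" for k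
    proof (cases "k + j = p")
      case True
      have "of_nat k + \<beta> j = of_nat (k + j) + of_nat p * s" by (simp add: \<beta>_def)
      also have "\<dots> = of_nat p * (s + 1)" unfolding True by (simp add: algebra_simps)
      finally show ?thesis using p_nonzero Zp_units_nonzero[OF s(2)] by simp
    next
      case False
      have "\<not> p dvd k + j"
      proof
        assume "p dvd k + j"
        then obtain i where i: "k + j = p * i" by blast
        have "p * i < p * 2" "p * i > 0" using i k j N r by linarith+
        then have "i = 1" by simp
        then show False using i False by simp
      qed
      then have "of_nat (k + j) + of_nat p * s \<in> Zp_units" using s Zp_units_of_p_mult_add by blast
      then show ?thesis using Zp_units_nonzero by (force simp: \<beta>_def algebra_simps)
    qed
    from sum_shift_recurrence[OF rec this]
    have "u j * S (\<beta> j + 1) = \<beta> j ^ 2 * S (\<beta> j) + of_nat N ^ 2 * c N / (of_nat N + \<beta> j)"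
      unfolding u_def S_def by blast
    moreover have "\<beta> j + 1 = \<beta> (Suc j)" by (simp add: \<beta>_def)
    ultimately show ?thesis using e(1)[OF j] by (simp only: \<beta>_def)
  qed
  \<comment> \<open>The invariant begins at \<open>\<beta> 1\<close>: \<open>S (\<beta> 0)\<close>
    contains \<open>1 / (p * s)\<close> and need not be \<open>p\<close>-integral, whereas the later
    sums are \<open>p\<close> times an element of \<open>Zp p\<close>.\<close>
  have "\<exists>X. Zp_cong p p X (Q * (\<Prod>i=1..j. of_nat i ^ 2) / (\<Prod>i<Suc j. v i)) \<and>
      S (\<beta> (Suc j)) = of_nat p * X"
    if "j < r" for j using that
  proof (induction j)
    case 0
    define y where "y = (\<Sum>k=1..<N. c k / (of_nat k + \<beta> 0))"
    have y: "y \<in> Zp p" unfolding y_def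
    proof (intro Zp_sum Zp_divide c)
      fix k assume "k \<in> {1..<N}"
      then have "\<not> p dvd k" using N by (auto dest: dvd_imp_le)
      then show "of_nat k + \<beta> 0 \<in> Zp_units" using Zp_units_of_p_mult_add s by (simp add: \<beta>_def)
    qed
    have "S (\<beta> 0) = 1 / \<beta> 0 + y"
      unfolding S_def y_def lessThan_atLeast0 using N c by (subst sum.atLeast_Suc_lessThan) auto
    \<comment> \<open>The factor \<open>\<beta> 0 ^ 2\<close> turns the singular term
      \<open>1 / \<beta> 0\<close> into \<open>\<beta> 0 = p * s\<close>, also for
      \<open>\<beta> 0 = 0\<close> as \<open>1 / 0 = 0\<close>; the rest is a multiple of
      \<open>p ^ 2\<close>.\<close>
    then have "\<beta> 0 ^ 2 * S (\<beta> 0) = \<beta> 0 + \<beta> 0 ^ 2 * y" by (simp add: algebra_simps power2_eq_square)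
    also have "\<dots> = of_nat p * (of_nat p * (s ^ 2 * y) + s)"
      by (simp add: \<beta>_def algebra_simps power2_eq_square)
    finally have "u 0 * S (\<beta> (Suc 0)) = of_nat p * (of_nat p * (s ^ 2 * y) + (s + e 0))"
      using step[of 0] r by (simp add: algebra_simps)
    then have "S (\<beta> (Suc 0)) = of_nat p * ((of_nat p * (s ^ 2 * y) + (s + e 0)) / u 0)"
      using Zp_units_nonzero[OF u_unit[OF r(1)]] by (simp add: field_simps)
    moreover have "Zp_cong p p (of_nat p * (s ^ 2 * y) + (s + e 0)) Q"
      using e(3) s y by (intro Zp_cong_trans[OF _ e(3)] Zp_cong_p_add) (auto simp: Zp_cong_def)
    then have "Zp_cong p p ((of_nat p * (s ^ 2 * y) + (s + e 0)) / u 0) (Q / v 0)"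
      by (intro Zp_cong_divide u_cong u_unit v r)
    ultimately show ?case by auto
  next
    case (Suc j)
    let ?P = "\<Prod>i=1..j. (of_nat i :: rat) ^ 2"
    obtain X where X: "Zp_cong p p X (Q * ?P / (\<Prod>i<Suc j. v i))" "S (\<beta> (Suc j)) = of_nat p * X"
      using Suc by auto
    have "u (Suc j) * S (\<beta> (Suc (Suc j))) = of_nat p * (\<beta> (Suc j) ^ 2 * X + e (Suc j))"
      using step[OF Suc.prems] X(2) by (simp add: algebra_simps)
    then have "S (\<beta> (Suc (Suc j))) = of_nat p * ((\<beta> (Suc j) ^ 2 * X + e (Suc j)) / u (Suc j))"
      using Zp_units_nonzero[OF u_unit[OF Suc.prems]] by (simp add: field_simps)
    moreover have "Zp_cong p p ((\<beta> (Suc j) ^ 2 * X + e (Suc j)) / u (Suc j))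
        ((of_nat (Suc j) ^ 2 * (Q * ?P / (\<Prod>i<Suc j. v i)) + 0) / v (Suc j))"
      using Suc.prems
      by (intro Zp_cong_divide Zp_cong_add Zp_cong_mult Zp_cong_power X \<beta>_cong e(2) u_cong u_unit v) auto
    moreover have "(of_nat (Suc j) ^ 2 * (Q * ?P / (\<Prod>i<Suc j. v i)) + 0) / v (Suc j) =
        Q * (\<Prod>i=1..Suc j. of_nat i ^ 2) / (\<Prod>i<Suc (Suc j). v i)"
      by (simp add: mult_ac)
    ultimately show ?case by metis
  qed
  from this[of "r - 1"] r obtain X where
    X: "Zp_cong p p X (Q * (\<Prod>i=1..r-1. of_nat i ^ 2) / (\<Prod>i<r. v i))" "S b = of_nat p * X"
    by (auto simp: \<beta>_def b)
  have b_cong: "Zp_cong p p b (of_nat r)" using \<beta>_cong[of r] by (simp add: \<beta>_def b)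
  have r_unit: "of_nat r \<in> Zp_units" using r by (intro Zp_units_of_nat) (auto dest: dvd_imp_le)
  then have b_unit: "b \<in> Zp_units" using b_cong Zp_cong_unit by blast
  let ?V = "\<Prod>i<r. v i" and ?P = "\<Prod>i=1..r. (of_nat i :: rat) ^ 2"
  have V: "?V \<in> Zp_units" using v by (intro Zp_units_prod) auto
  \<comment> \<open>The climb yields squares only up to \<open>r - 1\<close>. The factor
    \<open>r ^ 2\<close> is supplied above and below the fraction bar, and below it is then
    exchanged for \<open>b ^ 2\<close>, as \<open>b\<close> is congruent to
    \<open>r\<close>.\<close>
  have "(\<Prod>i=1..r. (of_nat i :: rat) ^ 2) = (\<Prod>i=1..r-1. of_nat i ^ 2) * of_nat r ^ 2"
    using r prod.atLeastAtMost_shift_bounds by (cases r) simp_all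
  then have "Q * (\<Prod>i=1..r-1. of_nat i ^ 2) / ?V = Q * ?P / (of_nat r ^ 2 * ?V)"
    using r by (simp add: field_simps)
  note X(1)[unfolded this]
  also have "Zp_cong p p (Q * ?P / (of_nat r ^ 2 * ?V)) (Q * ?P / (b ^ 2 * ?V))"
  proof (intro Zp_cong_divide Zp_cong_mult Zp_cong_refl Zp_cong_power Zp_units_mult Zp_units_power
      V b_unit r_unit Zp_cong_sym[OF b_cong] Zp_units_Zp[OF V] Q)
    show "?P \<in> Zp p" by (simp flip: of_nat_power of_nat_prod)
  qed
  finally show ?thesis unfolding X(2)[unfolded S_def] by (rule Zp_cong_p_mult)
qed

text \<open>Case \<open>N = p\<close>. Here \<open>e j = p * c p / (p * (s + 1) + j)\<close> is a
  multiple of \<open>p\<close> for \<open>0 < j < r\<close>. For \<open>j = 0\<close> the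
  \<open>p\<close> cancels, and \<open>e 0\<close> is congruent to
  \<open>w / (s + 1)\<close>.\<close>

lemma full_sum_cong:
  fixes c v :: "nat \<Rightarrow> rat" and w s :: rat
  assumes s: "s \<in> Zp p" "s + 1 \<in> Zp_units"
    and r: "0 < r" "r < p" and b: "b = of_nat p * s + of_nat r"
    and c: "c 0 = 1" "\<And>k. c k \<in> Zp p" "Zp_cong p p (c p) w"
    and rec: "\<And>k. (of_nat k + 1) ^ 2 * c (Suc k) = (of_nat k ^ 2 + of_nat k + w) * c k"
    and v: "\<And>j. j < r \<Longrightarrow> v j \<in> Zp_units"
      "\<And>j. j < r \<Longrightarrow> Zp_cong p p (w + of_nat j + of_nat j ^ 2) (v j)"
  shows "Zp_cong p (p ^ 2) (\<Sum>k=0..p-1. c k / (of_nat k + b))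
    (of_nat p * ((s ^ 2 + s + w) / (s + 1) * (\<Prod>j=1..r. of_nat j ^ 2) / (b ^ 2 * (\<Prod>j<r. v j))))"
proof -
  define e where "e j = of_nat p * c p / (of_nat p + (of_nat p * s + of_nat j))" for j
  have p0: "p > 0" using prime_p by (simp add: prime_gt_0_nat)
  have "{0..p-1} = {..<p}" using p0 by auto
  moreover have "Zp_cong p (p ^ 2) (\<Sum>k<p. c k / (of_nat k + b))
    (of_nat p * ((s ^ 2 + s + w) / (s + 1) * (\<Prod>j=1..r. of_nat j ^ 2) / (b ^ 2 * (\<Prod>j<r. v j))))"
  proof (rule truncated_sum_cong[where e = e and c = c and v = v and w = w,
        OF s p0 order_refl r b c(1,2) rec v])
    show "of_nat p ^ 2 * c p / (of_nat p + (of_nat p * s + of_nat j)) = of_nat p * e j" for j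
      by (simp add: e_def power2_eq_square mult_ac)
    show "Zp_cong p p (e j) 0" if j: "0 < j" "j < r" for j
    proof -
      have "\<not> p dvd j" using j r by (auto dest: dvd_imp_le)
      then have "of_nat j + of_nat p * (s + 1) \<in> Zp_units"
        using s by (intro Zp_units_of_p_mult_add) simp_all
      then have "c p / (of_nat j + of_nat p * (s + 1)) \<in> Zp p" using c by simp
      from Zp_cong_p_add[OF this Zp_numeral(1)] show ?thesis by (simp add: e_def algebra_simps)
    qed
    have "e 0 = of_nat p * c p / (of_nat p * (s + 1))" by (simp add: e_def algebra_simps)
    then have "s + e 0 = s + c p / (s + 1)" using p_nonzero by simp
    also have "Zp_cong p p \<dots> (s + w / (s + 1))"
      using s c by (intro Zp_cong_add Zp_cong_divide Zp_cong_refl) simp_all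
    also have "s + w / (s + 1) = (s ^ 2 + s + w) / (s + 1)"
      using Zp_units_nonzero[OF s(2)] by (simp add: field_simps power2_eq_square)
    finally show "Zp_cong p p (s + e 0) ((s ^ 2 + s + w) / (s + 1))" .
  qed
  ultimately show ?thesis by (simp only:)
qed

text \<open>The factors \<open>w + j + j^2\<close> become \<open>-(n - j) * (n + 1 + j)\<close>,
  with product \<open>(-1)^r * (n + r)! / (n - r)!\<close>. Dividing \<open>(r!)^2\<close> by it
  gives, up to sign, the reciprocal of the two binomials, between which \<open>(2 * r)!\<close>
  cancels.\<close>

lemma full_sum_binomial_cong:
  fixes c :: "nat \<Rightarrow> rat" and w s :: rat
  assumes s: "s \<in> Zp p" "s + 1 \<in> Zp_units"
    and r: "0 < r" "r \<le> n" "2 * n < p" and b: "b = of_nat p * s + of_nat r"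
    and c: "c 0 = 1" "\<And>k. c k \<in> Zp p" "Zp_cong p p (c p) w"
    and rec: "\<And>k. (of_nat k + 1) ^ 2 * c (Suc k) = (of_nat k ^ 2 + of_nat k + w) * c k"
    and w: "Zp_cong p p w (- (of_nat n * (of_nat n + 1)))"
  shows "Zp_cong p (p ^ 2) (\<Sum>k=0..p-1. c k / (of_nat k + b))
    ((- 1) ^ r * ((s ^ 2 + s + w) * of_nat p / (b ^ 2 * (s + 1) * of_nat ((2 * r) choose r)
       * of_nat ((n + r) choose (n - r)))))"
proof -
  define v :: "nat \<Rightarrow> rat" where "v j = - of_nat ((n - j) * (n + 1 + j))" for j
  have "r < p" using r by simp
  note * = full_sum_cong[where v = v and c = c and w = w, OF s r(1) this b c rec]
  have v_unit: "v j \<in> Zp_units" if j: "j < r" for j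
  proof -
    \<comment> \<open>\<open>2 * n < p\<close> and \<open>j < r \<le> n\<close> keep both factors
      strictly between 0 and \<open>p\<close>.\<close>
    have "0 < n - j" "n - j < p" "0 < n + 1 + j" "n + 1 + j < p" using j r by linarith+
    then have "\<not> p dvd n - j" "\<not> p dvd n + 1 + j" by (simp_all add: nat_dvd_not_less)
    then have "\<not> p dvd (n - j) * (n + 1 + j)" using prime_p prime_dvd_mult_iff by blast
    then show ?thesis unfolding v_def by (intro Zp_units_uminus Zp_units_of_nat)
  qed
  have v_cong: "Zp_cong p p (w + of_nat j + of_nat j ^ 2) (v j)" if j: "j < r" for j
  proof -
    have "v j = - (of_nat n * (of_nat n + 1)) + of_nat j + of_nat j ^ 2"
    proof -
      obtain k where "n = j + k" using j r le_Suc_ex[of j n] by auto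
      then show ?thesis by (simp add: v_def algebra_simps power2_eq_square)
    qed
    then show ?thesis using w by (simp only:) (intro Zp_cong_add Zp_cong_refl, simp_all)
  qed
  have prod_v: "(\<Prod>j<i. v j) = (- 1) ^ i * (fact (n + i) / fact (n - i))" if "i \<le> n" for i
    using that
  proof (induction i)
    case (Suc i)
    then obtain k where k: "n = Suc i + k" using le_Suc_ex by blast
    have "n - i = Suc k" "n - Suc i = k" using k by simp_all
    then have "v i = - (of_nat (Suc k) * of_nat (Suc (n + i)))" by (simp add: v_def algebra_simps)
    moreover have "(\<Prod>j<i. v j) = (- 1) ^ i * (fact (n + i) / fact (Suc k))"
      using Suc \<open>n - i = Suc k\<close> by simp
    moreover have "of_nat (Suc k) / fact (Suc k) = (1 / fact k :: rat)"
      unfolding fact_Suc by (simp del: of_nat_Suc)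
    moreover have "fact (n + Suc i) = (of_nat (Suc (n + i)) * fact (n + i) :: rat)"
      unfolding add_Suc_right fact_Suc by simp
    ultimately show ?case
      unfolding prod.lessThan_Suc \<open>n - Suc i = k\<close> by (simp add: field_simps del: of_nat_Suc fact_Suc)
  qed simp
  have prod_sq: "(\<Prod>j=1..r. (of_nat j :: rat) ^ 2) = fact r ^ 2"
    by (simp add: prod_power_distrib fact_prod)
  have ch: "(of_nat ((2 * r) choose r) :: rat) = fact (2 * r) / (fact r * fact r)"
      "(of_nat ((n + r) choose (n - r)) :: rat) = fact (n + r) / (fact (n - r) * fact (2 * r))"
    using r by (simp_all add: binomial_fact mult_2)
  have "of_nat p * ((s ^ 2 + s + w) / (s + 1) * (\<Prod>j=1..r. of_nat j ^ 2) / (b ^ 2 * (\<Prod>j<r. v j))) =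
      (- 1) ^ r * ((s ^ 2 + s + w) * of_nat p / (b ^ 2 * (s + 1) * of_nat ((2 * r) choose r)
       * of_nat ((n + r) choose (n - r))))"
    \<comment> \<open>The parity split moves the sign from the denominator to the numerator.\<close>
    unfolding prod_v[OF r(2)] prod_sq ch
    by (cases "even r") (simp_all add: power2_eq_square mult_ac)
  then show ?thesis using *[OF v_unit v_cong] by simp
qed

section \<open>The families with \<open>m = 3, 4, 6\<close>\<close>

text \<open>With \<open>a = -1/m\<close> the left side is \<open>-a * (a + 1)\<close>. Modulo
  \<open>p\<close>, \<open>p div m\<close> is \<open>a\<close> if \<open>p mod m = 1\<close> and
  \<open>-1 - a\<close> if \<open>p mod m = m - 1\<close>, and \<open>x * (x + 1)\<close> agrees at
  these two points.\<close>

lemma residue_w_cong: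
  assumes m: "\<not> p dvd m" "p mod m = 1 \<or> p mod m = m - 1" "m > 0"
  shows "Zp_cong p p ((of_nat m - 1) / of_nat m ^ 2)
    (- (of_nat (p div m) * (of_nat (p div m) + 1)))"
proof -
  define n \<rho> M :: rat where "n = of_nat (p div m)" and "\<rho> = of_nat (p mod m)" and "M = of_nat m"
  have "p = m * (p div m) + p mod m" by simp
  then have "(of_nat p :: rat) = of_nat (m * (p div m) + p mod m)" by (rule arg_cong)
  then have p_eq: "of_nat p = M * n + \<rho>"
    unfolding n_def \<rho>_def M_def by (simp only: of_nat_add of_nat_mult)
  have \<rho>: "\<rho> = 1 \<or> \<rho> = M - 1" using m by (auto simp: \<rho>_def M_def of_nat_diff)
  have M: "M \<in> Zp_units" unfolding M_def by (rule Zp_units_of_nat[OF m(1)])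
  have "(M - 1) + M ^ 2 * (n * (n + 1)) = of_nat p * (of_nat p - 2 * \<rho> + M)"
    using \<rho> unfolding p_eq by (auto simp: algebra_simps power2_eq_square)
  then have "(M - 1) / M ^ 2 - (- (n * (n + 1))) = of_nat p * ((of_nat p - 2 * \<rho> + M) / M ^ 2)"
    using Zp_units_nonzero[OF M] by (simp add: field_simps)
  moreover have "(of_nat p - 2 * \<rho> + M) / M ^ 2 \<in> Zp p" "(M - 1) / M ^ 2 \<in> Zp p"
    using Zp_units_power[OF M] by (auto simp: M_def \<rho>_def)
  moreover have "- (n * (n + 1)) \<in> Zp p" by (simp add: n_def)
  ultimately show ?thesis unfolding n_def M_def Zp_cong_def by blast
qed

lemma Zp_cong_power_p: "Zp_cong p p (of_nat a ^ p) (of_nat a)"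
proof -
  have p: "p = Suc (p - 1)" using prime_gt_0_nat[OF prime_p] by simp
  have "[a ^ p = a] (mod p)"
  proof (cases "p dvd a")
    case True
    then have "p dvd a ^ p" using prime_p prime_dvd_power_iff p by (metis zero_less_Suc)
    then show ?thesis using True by (simp add: cong_def)
  next
    case False
    have "a ^ p = a * a ^ (p - 1)" using p power_Suc by metis
    also have "[\<dots> = a * 1] (mod p)" by (intro cong_scalar_left fermat_theorem prime_p False)
    finally show ?thesis by simp
  qed
  from Zp_cong_of_nat[OF this] show ?thesis by simp
qed

text \<open>Reduces \<open>c p\<close> to \<open>c 1\<close> modulo \<open>p\<close>: the numerator
  by \<open>choose_prime_mult_cong\<close>, the denominator by Fermat.\<close>

lemma binomial_ratio_cong:
  assumes "\<not> p dvd a"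
  shows "Zp_cong p p
    (of_nat ((m * p) choose (j * p)) * of_nat ((m' * p) choose (j' * p)) / of_nat a ^ p)
    (of_nat (m choose j) * of_nat (m' choose j') / of_nat a)"
  using assms
  by (intro Zp_cong_divide Zp_cong_mult Zp_cong_of_nat choose_prime_mult_cong prime_p
      Zp_cong_power_p Zp_units_power Zp_units_of_nat)

text \<open>Common form of the sums with bases 27, 64 and 432. The two descriptions of
  \<open>w\<close> have different uses: as \<open>c 1\<close> it is the residue of
  \<open>c p\<close>, and as \<open>(m - 1) / m^2\<close> it makes \<open>n = p div m\<close> the
  parameter of \<open>full_sum_binomial_cong\<close>.\<close>

lemma binomial_family_sum_cong:
  fixes c :: "nat \<Rightarrow> rat" and w s b :: rat
  assumes s: "s \<in> Zp p" "s + 1 \<in> Zp_units"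
    and b: "b = of_nat p * s + of_nat r"
    and m: "2 < m" "\<not> p dvd m" "p mod m = 1 \<or> p mod m = m - 1"
    and r: "0 < r" "(of_nat r :: rat) < of_nat p / of_nat m"
    and a: "\<not> p dvd a"
    and c: "\<And>k. c k = of_nat ((i * k) choose (j * k)) * of_nat ((i' * k) choose (j' * k)) / of_nat a ^ k"
    and rec: "\<And>k. (of_nat k + 1) ^ 2 * c (Suc k) = (of_nat k ^ 2 + of_nat k + w) * c k"
    and w: "w = of_nat (i choose j) * of_nat (i' choose j') / of_nat a"
      "w = (of_nat m - 1) / of_nat m ^ 2"
  shows "Zp_cong p (p ^ 2) (\<Sum>k=0..p-1. c k / (of_nat k + b))
    ((- 1) ^ r * ((s ^ 2 + s + w) * of_nat p / (b ^ 2 * (s + 1) * of_nat ((2 * r) choose r)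
       * of_nat ((p div m + r) choose (p div m - r)))))"
proof (rule full_sum_binomial_cong[where c = c and w = w, OF s r(1) _ _ b _ _ _ rec])
  have "(of_nat (r * m) :: rat) < of_nat p" using r m by (simp add: field_simps)
  then have "r * m < p" by (simp only: of_nat_less_iff)
  then show "r \<le> p div m" using m by (simp add: less_eq_div_iff_mult_less_eq)
  then have "0 < p div m" using r by simp
  then have "2 * (p div m) < m * (p div m)" using m by simp
  also have "\<dots> \<le> p" by simp
  finally show "2 * (p div m) < p" .
  show "c 0 = 1" by (simp add: c)
  show "c k \<in> Zp p" for k
    unfolding c by (intro Zp_divide Zp_mult Zp_of_nat Zp_units_power Zp_units_of_nat a)
  show "Zp_cong p p (c p) w"
    unfolding c w(1) by (rule binomial_ratio_cong[OF a])
  show "Zp_cong p p w (- (of_nat (p div m) * (of_nat (p div m) + 1)))"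
    unfolding w(2) using m by (intro residue_w_cong) auto
qed

section \<open>Squares of central binomial coefficients\<close>

text \<open>Since \<open>n\<close> is congruent to \<open>-1/2\<close>, both sides are congruent to
  \<open>(j + 1/2)^2\<close>. This square form of the factor leads to the square of
  \<open>n choose r\<close>.\<close>

lemma half_w_cong:
  assumes p: "p = 2 * n + 1" and j: "j \<le> n"
  shows "Zp_cong p p (1 / 4 + of_nat j + of_nat j ^ 2) (of_nat (n - j) ^ 2)"
proof -
  have "\<not> p dvd 2" using p prime_p by (cases n) (auto dest: dvd_imp_le)
  then have "\<not> p dvd 4" using prime_dvd_mult_iff[OF prime_p, of 2 2] by simp
  from Zp_units_of_nat[OF this] have four: "4 \<in> Zp_units" by simp
  have "1 / 4 + of_nat j + of_nat j ^ 2 - of_nat (n - j) ^ 2 =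
      of_nat p * ((4 * of_nat j + 2 - of_nat p) / 4 :: rat)"
  proof -
    obtain k where "n = j + k" using j le_Suc_ex by blast
    then show ?thesis by (simp add: p power2_eq_square field_simps)
  qed
  moreover have "(4 * of_nat j + 2 - of_nat p) / 4 \<in> Zp p" "1 / 4 \<in> Zp p" using four by auto
  moreover have "1 / 4 + of_nat j + of_nat j ^ 2 \<in> Zp p" "of_nat (n - j) ^ 2 \<in> Zp p"
    using four by (simp_all del: of_nat_diff)
  ultimately show ?thesis unfolding Zp_cong_def by blast
qed

text \<open>Both sums use \<open>v j = (n - j)^2\<close>. The full sum takes its boundary term from
  \<open>c p\<close>; in the half sum, with \<open>N = n + 1\<close>, the factor
  \<open>p ^ 2\<close> of \<open>c N\<close> removes every boundary term, so that
  \<open>Q = s\<close>.\<close>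

lemma central_binomial_sq_sums_cong:
  fixes c :: "nat \<Rightarrow> rat" and s b :: rat
  assumes s: "s \<in> Zp p" "s + 1 \<in> Zp_units"
    and b: "b = of_nat p * s + of_nat r"
    and p: "p = 2 * n + 1" and r: "0 < r" "r \<le> n"
    and c: "\<And>k. c k = of_nat ((2 * k) choose k) ^ 2 / 16 ^ k"
  shows "Zp_cong p (p ^ 2) (\<Sum>k=0..p-1. c k / (of_nat k + b))
      ((s + 1 / 2) ^ 2 * of_nat p / (b ^ 2 * (s + 1) * of_nat (n choose r) ^ 2))"
    and "Zp_cong p (p ^ 2) (\<Sum>k=0..n. c k / (of_nat k + b))
      (of_nat p * s / (b ^ 2 * of_nat (n choose r) ^ 2))"
proof -
  define v :: "nat \<Rightarrow> rat" where "v j = of_nat (n - j) ^ 2" for j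
  have rec: "(of_nat k + 1) ^ 2 * c (Suc k) = (of_nat k ^ 2 + of_nat k + 1 / 4) * c k" for k
    by (rule choose_2_choose_2_recurrence[OF c])
  have p2: "\<not> p dvd 2" using p r by (auto dest: dvd_imp_le)
  then have "\<not> p dvd 2 ^ 4" using prime_dvd_power prime_p by blast
  then have p16: "\<not> p dvd 16" by simp
  then have unit16: "16 ^ k \<in> Zp_units" for k using Zp_units_power[OF Zp_units_of_nat[of 16]] by simp
  have c_Zp: "c k \<in> Zp p" for k unfolding c using unit16 by simp
  \<comment> \<open>\<open>c 1 = 2^2 / 16 = 1 / 4\<close>.\<close>
  have c_p: "Zp_cong p p (c p) (1 / 4)"
    using binomial_ratio_cong[OF p16, of 2 1 2 1] by (simp add: c power2_eq_square)
  have rp: "r < p" using p r by simp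
  have v: "v j \<in> Zp_units" "Zp_cong p p (1 / 4 + of_nat j + of_nat j ^ 2) (v j)" if "j < r" for j
  proof -
    have "\<not> p dvd n - j" using that p r by (intro nat_dvd_not_less) auto
    then show "v j \<in> Zp_units" unfolding v_def by (intro Zp_units_power Zp_units_of_nat)
    show "Zp_cong p p (1 / 4 + of_nat j + of_nat j ^ 2) (v j)"
      unfolding v_def using that r p by (intro half_w_cong) auto
  qed
  have prod: "of_nat p * (Q * (\<Prod>j=1..r. of_nat j ^ 2) / (b ^ 2 * (\<Prod>j<r. v j))) =
      of_nat p * Q / (b ^ 2 * of_nat (n choose r) ^ 2)" for Q
    unfolding v_def times_divide_eq_right[symmetric] prod_sq_eq_choose_sq[OF r(2)] by simp
  have "Zp_cong p (p ^ 2) (\<Sum>k=0..p-1. c k / (of_nat k + b))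
      (of_nat p * ((s ^ 2 + s + 1 / 4) / (s + 1)) / (b ^ 2 * of_nat (n choose r) ^ 2))"
    unfolding prod[symmetric]
    by (rule full_sum_cong[where c = c and v = v and w = "1 / 4",
          OF s r(1) rp b _ c_Zp c_p rec v]) (simp add: c)
  moreover have "of_nat p * ((s ^ 2 + s + 1 / 4) / (s + 1)) / (b ^ 2 * of_nat (n choose r) ^ 2) =
      (s + 1 / 2) ^ 2 * of_nat p / (b ^ 2 * (s + 1) * of_nat (n choose r) ^ 2)"
  proof -
    have "s ^ 2 + s + 1 / 4 = (s + 1 / 2) ^ 2" by (simp add: power2_eq_square algebra_simps)
    then show ?thesis by (simp add: mult_ac)
  qed
  ultimately show "Zp_cong p (p ^ 2) (\<Sum>k=0..p-1. c k / (of_nat k + b))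
      ((s + 1 / 2) ^ 2 * of_nat p / (b ^ 2 * (s + 1) * of_nat (n choose r) ^ 2))" by simp

  \<comment> \<open>As \<open>2 * n + 1 = p\<close>, Pascal's rule gives a sum of two inner entries
    of row \<open>p\<close>.\<close>
  have "p dvd (2 * Suc n) choose Suc n"
  proof -
    have "(2 * Suc n) choose Suc n = (p choose n) + (p choose Suc n)" by (simp add: p)
    moreover have "p dvd p choose n" "p dvd p choose Suc n"
      by (rule dvd_choose_prime[OF _ _ _ prime_p]; use p r in simp)+
    ultimately show ?thesis by simp
  qed
  then obtain t where t: "(2 * Suc n) choose Suc n = p * t" by blast
  \<comment> \<open>Of the \<open>p ^ 2\<close> in \<open>c (Suc n)\<close>, one \<open>p\<close>
    goes into the shape \<open>p * e j\<close> of the boundary term; the other makes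
    \<open>e j\<close> vanish modulo \<open>p\<close>, at \<open>j = 0\<close> too.\<close>
  define e where "e j = of_nat p * (of_nat (Suc n) ^ 2 * (of_nat t ^ 2 / 16 ^ Suc n) /
      (of_nat (Suc n) + (of_nat p * s + of_nat j)))" for j
  have e_0: "Zp_cong p p (e j) 0" if "j < r" for j
  proof -
    have "\<not> p dvd Suc n + j" using p r that by (intro nat_dvd_not_less) auto
    then have "of_nat (Suc n + j) + of_nat p * s \<in> Zp_units" using s Zp_units_of_p_mult_add by blast
    then have "of_nat (Suc n) + (of_nat p * s + of_nat j) \<in> Zp_units" by (simp add: add_ac)
    then have "of_nat (Suc n) ^ 2 * (of_nat t ^ 2 / 16 ^ Suc n) /
        (of_nat (Suc n) + (of_nat p * s + of_nat j)) \<in> Zp p"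
      by (intro Zp_divide Zp_mult Zp_power Zp_of_nat unit16)
    from Zp_cong_p_add[OF this Zp_numeral(1)] show ?thesis by (simp add: e_def)
  qed
  have "{0..n} = {..<Suc n}" by auto
  moreover have "Zp_cong p (p ^ 2) (\<Sum>k<Suc n. c k / (of_nat k + b))
      (of_nat p * s / (b ^ 2 * of_nat (n choose r) ^ 2))"
    unfolding prod[symmetric]
  proof (rule truncated_sum_cong[where c = c and v = v and w = "1 / 4" and e = e,
        OF s _ _ r(1) rp b _ c_Zp rec v _ e_0])
    show "of_nat (Suc n) ^ 2 * c (Suc n) / (of_nat (Suc n) + (of_nat p * s + of_nat j)) =
        of_nat p * e j" for j
      unfolding e_def c t by (simp add: power2_eq_square mult_ac del: of_nat_Suc power_Suc)
    show "Zp_cong p p (s + e 0) s"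
      using Zp_cong_add[OF Zp_cong_refl[OF s(1)] e_0[OF r(1)]] by simp
  qed (use p c r in auto)
  ultimately show "Zp_cong p (p ^ 2) (\<Sum>k=0..n. c k / (of_nat k + b))
      (of_nat p * s / (b ^ 2 * of_nat (n choose r) ^ 2))" by simp
qed

end

section \<open>Assembly of the four cases\<close>

theorem theorem2p2:
  fixes p :: nat and b s :: rat
  assumes "prime p" and "p > 3"
    and "b \<in> Zp p"
    and "Zp_res p b \<noteq> 0"
    and "s = (b - of_nat (Zp_res p b)) / of_nat p"
    and "\<not> Zp_cong p p s (- 1)"
  shows
    "((of_nat (Zp_res p b) :: rat) < of_nat p / 2 \<longrightarrow>
        Zp_cong p (p ^ 2)
          (\<Sum>k = 0..p - 1. of_nat ((2 * k) choose k) ^ 2 / (16 ^ k * (of_nat k + b)))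
          ((s + 1 / 2) ^ 2 * of_nat p
             / (b ^ 2 * (s + 1) * of_nat (((p - 1) div 2) choose Zp_res p b) ^ 2))
      \<and> Zp_cong p (p ^ 2)
          (\<Sum>k = 0..(p - 1) div 2. of_nat ((2 * k) choose k) ^ 2 / (16 ^ k * (of_nat k + b)))
          ((b - of_nat (Zp_res p b))
             / (b ^ 2 * of_nat (((p - 1) div 2) choose Zp_res p b) ^ 2)))
   \<and> ((of_nat (Zp_res p b) :: rat) < of_nat p / 3 \<longrightarrow>
        Zp_cong p (p ^ 2)
          (\<Sum>k = 0..p - 1. of_nat ((2 * k) choose k) * of_nat ((3 * k) choose k)
             / (27 ^ k * (of_nat k + b)))
          ((- 1) ^ Zp_res p b * ((s + 1 / 3) * (s + 2 / 3) * of_nat p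
             / (b ^ 2 * (s + 1) * of_nat ((2 * Zp_res p b) choose Zp_res p b)
                * of_nat ((p div 3 + Zp_res p b) choose (p div 3 - Zp_res p b))))))
   \<and> ((of_nat (Zp_res p b) :: rat) < of_nat p / 4 \<longrightarrow>
        Zp_cong p (p ^ 2)
          (\<Sum>k = 0..p - 1. of_nat ((2 * k) choose k) * of_nat ((4 * k) choose (2 * k))
             / (64 ^ k * (of_nat k + b)))
          ((- 1) ^ Zp_res p b * ((s + 1 / 4) * (s + 3 / 4) * of_nat p
             / (b ^ 2 * (s + 1) * of_nat ((2 * Zp_res p b) choose Zp_res p b)
                * of_nat ((p div 4 + Zp_res p b) choose (p div 4 - Zp_res p b))))))
   \<and> ((of_nat (Zp_res p b) :: rat) < of_nat p / 6 \<longrightarrow>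
        Zp_cong p (p ^ 2)
          (\<Sum>k = 0..p - 1. of_nat ((3 * k) choose k) * of_nat ((6 * k) choose (3 * k))
             / (432 ^ k * (of_nat k + b)))
          ((- 1) ^ Zp_res p b * ((s + 1 / 6) * (s + 5 / 6) * of_nat p
             / (b ^ 2 * (s + 1) * of_nat ((2 * Zp_res p b) choose Zp_res p b)
                * of_nat ((p div 6 + Zp_res p b) choose (p div 6 - Zp_res p b))))))"
proof -
  interpret prime_localization p by unfold_locales (rule assms(1))
  define r where "r = Zp_res p b"
  have "r < p \<and> Zp_cong p p b (of_nat r)"
    unfolding r_def Zp_res_def using theI'[OF Zp_res_ex1[OF assms(1,3)]] .
  then obtain z where z: "z \<in> Zp p" "b - of_nat r = of_nat p * z"
    by (auto simp: Zp_cong_def)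
  then have "s = z" using assms(5) p_nonzero by (simp add: r_def)
  then have s: "s \<in> Zp p" and b: "b = of_nat p * s + of_nat r" using z by (auto simp: algebra_simps)
  have s1: "s + 1 \<in> Zp_units"
  proof (rule ccontr)
    assume "s + 1 \<notin> Zp_units"
    then have "Zp_cong p p (s + 1) 0" using s by (intro nonunit_Zp_cong_0) simp_all
    from Zp_cong_add[OF this Zp_cong_refl[of "- 1"]] show False using assms(6) by simp
  qed
  have r0: "0 < r" using assms(4) by (simp add: r_def)
  \<comment> \<open>Covers every modulus \<open>m\<close> (3, 4, 6) and base (27, 64, 432)
    below.\<close>
  have not_dvd: "\<not> p dvd 2 ^ i * 3 ^ j" for i j
  proof
    assume "p dvd 2 ^ i * 3 ^ j"
    then have "p dvd 2 \<or> p dvd 3" using assms(1) prime_dvd_mult_iff prime_dvd_power by blast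
    then show False using assms(2) by (auto dest: dvd_imp_le)
  qed
  have p_mod_6: "p mod 6 = 1 \<or> p mod 6 = 5"
  proof -
    have "\<not> q dvd p" if "prime q" "q \<le> 3" for q
      using assms(1,2) primes_dvd_imp_eq[OF that(1) assms(1)] that(2) by auto
    from this[of 2] this[of 3] have "\<not> 2 dvd p" "\<not> 3 dvd p" by simp_all
    then show ?thesis by presburger
  qed
  have "odd p" using p_mod_6 by presburger
  then obtain n where p: "p = 2 * n + 1" by (elim oddE)
  have n: "(p - 1) div 2 = n" by (simp add: p)
  show ?thesis
    unfolding r_def[symmetric]
  proof (intro conjI impI)
    assume "(of_nat r :: rat) < of_nat p / 2"
    then have "(of_nat (2 * r) :: rat) < of_nat (2 * n + 1)" by (simp add: p)
    then have "r \<le> n" unfolding of_nat_less_iff by simp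
    note * = central_binomial_sq_sums_cong[OF s s1 b p r0 this refl]
    show "Zp_cong p (p ^ 2)
        (\<Sum>k = 0..p - 1. of_nat ((2 * k) choose k) ^ 2 / (16 ^ k * (of_nat k + b)))
        ((s + 1 / 2) ^ 2 * of_nat p / (b ^ 2 * (s + 1) * of_nat (((p - 1) div 2) choose r) ^ 2))"
      using *(1) unfolding n divide_divide_eq_left .
    have "of_nat p * s = b - of_nat r" by (simp add: b)
    then show "Zp_cong p (p ^ 2)
        (\<Sum>k = 0..(p - 1) div 2. of_nat ((2 * k) choose k) ^ 2 / (16 ^ k * (of_nat k + b)))
        ((b - of_nat r) / (b ^ 2 * of_nat (((p - 1) div 2) choose r) ^ 2))"
      using *(2) unfolding n divide_divide_eq_left by simp
  next
    assume r: "(of_nat r :: rat) < of_nat p / 3"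
    define c :: "nat \<Rightarrow> rat" where
      "c k = of_nat ((2 * k) choose k) * of_nat ((3 * k) choose k) / 27 ^ k" for k
    have w: "s ^ 2 + s + 2 / 9 = (s + 1 / 3) * (s + 2 / 3)" by (simp add: power2_eq_square field_simps)
    have p_mod: "p mod 3 = 1 \<or> p mod 3 = 3 - 1" using p_mod_6 by presburger
    have "Zp_cong p (p ^ 2) (\<Sum>k=0..p-1. c k / (of_nat k + b))
        ((- 1) ^ r * ((s ^ 2 + s + 2 / 9) * of_nat p / (b ^ 2 * (s + 1) * of_nat ((2 * r) choose r)
          * of_nat ((p div 3 + r) choose (p div 3 - r)))))"
    \<comment> \<open>Here \<open>w = 2 * 3 / 27 = (3 - 1) / 3^2 = 2 / 9\<close>.\<close>
    proof (rule binomial_family_sum_cong[where m = 3 and a = 27 and i = 2 and j = 1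
          and i' = 3 and j' = 1 and c = c, OF s s1 b _ _ p_mod r0])
      show "\<not> p dvd 3" "\<not> p dvd 27" using not_dvd[of 0 1] not_dvd[of 0 3] by simp_all
      show "(of_nat k + 1) ^ 2 * c (Suc k) = (of_nat k ^ 2 + of_nat k + 2 / 9) * c k" for k
        by (rule choose_2_choose_3_recurrence[OF c_def])
      show "(of_nat r :: rat) < of_nat p / of_nat 3" using r by simp
    qed (simp_all add: c_def eval_nat_numeral)
    then show "Zp_cong p (p ^ 2)
        (\<Sum>k = 0..p - 1. of_nat ((2 * k) choose k) * of_nat ((3 * k) choose k) / (27 ^ k * (of_nat k + b)))
        ((- 1) ^ r * ((s + 1 / 3) * (s + 2 / 3) * of_nat p / (b ^ 2 * (s + 1) * of_nat ((2 * r) choose r)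
          * of_nat ((p div 3 + r) choose (p div 3 - r)))))"
      unfolding w c_def divide_divide_eq_left .
  next
    assume r: "(of_nat r :: rat) < of_nat p / 4"
    define c :: "nat \<Rightarrow> rat" where
      "c k = of_nat ((2 * k) choose k) * of_nat ((4 * k) choose (2 * k)) / 64 ^ k" for k
    have w: "s ^ 2 + s + 3 / 16 = (s + 1 / 4) * (s + 3 / 4)" by (simp add: power2_eq_square field_simps)
    have p_mod: "p mod 4 = 1 \<or> p mod 4 = 4 - 1" using \<open>odd p\<close> by presburger
    have "Zp_cong p (p ^ 2) (\<Sum>k=0..p-1. c k / (of_nat k + b))
        ((- 1) ^ r * ((s ^ 2 + s + 3 / 16) * of_nat p / (b ^ 2 * (s + 1) * of_nat ((2 * r) choose r)
          * of_nat ((p div 4 + r) choose (p div 4 - r)))))"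
    \<comment> \<open>Here \<open>w = 2 * 6 / 64 = (4 - 1) / 4^2 = 3 / 16\<close>.\<close>
    proof (rule binomial_family_sum_cong[where m = 4 and a = 64 and i = 2 and j = 1
          and i' = 4 and j' = 2 and c = c, OF s s1 b _ _ p_mod r0])
      show "\<not> p dvd 4" "\<not> p dvd 64" using not_dvd[of 2 0] not_dvd[of 6 0] by simp_all
      show "(of_nat k + 1) ^ 2 * c (Suc k) = (of_nat k ^ 2 + of_nat k + 3 / 16) * c k" for k
        by (rule choose_2_choose_4_recurrence[OF c_def])
      show "(of_nat r :: rat) < of_nat p / of_nat 4" using r by simp
    qed (simp_all add: c_def eval_nat_numeral)
    then show "Zp_cong p (p ^ 2)
        (\<Sum>k = 0..p - 1. of_nat ((2 * k) choose k) * of_nat ((4 * k) choose (2 * k)) / (64 ^ k * (of_nat k + b)))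
        ((- 1) ^ r * ((s + 1 / 4) * (s + 3 / 4) * of_nat p / (b ^ 2 * (s + 1) * of_nat ((2 * r) choose r)
          * of_nat ((p div 4 + r) choose (p div 4 - r)))))"
      unfolding w c_def divide_divide_eq_left .
  next
    assume r: "(of_nat r :: rat) < of_nat p / 6"
    define c :: "nat \<Rightarrow> rat" where
      "c k = of_nat ((3 * k) choose k) * of_nat ((6 * k) choose (3 * k)) / 432 ^ k" for k
    have w: "s ^ 2 + s + 5 / 36 = (s + 1 / 6) * (s + 5 / 6)" by (simp add: power2_eq_square field_simps)
    have p_mod: "p mod 6 = 1 \<or> p mod 6 = 6 - 1" using p_mod_6 by simp
    have "Zp_cong p (p ^ 2) (\<Sum>k=0..p-1. c k / (of_nat k + b))
        ((- 1) ^ r * ((s ^ 2 + s + 5 / 36) * of_nat p / (b ^ 2 * (s + 1) * of_nat ((2 * r) choose r)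
          * of_nat ((p div 6 + r) choose (p div 6 - r)))))"
    \<comment> \<open>Here \<open>w = 3 * 20 / 432 = (6 - 1) / 6^2 = 5 / 36\<close>.\<close>
    proof (rule binomial_family_sum_cong[where m = 6 and a = 432 and i = 3 and j = 1
          and i' = 6 and j' = 3 and c = c, OF s s1 b _ _ p_mod r0])
      show "\<not> p dvd 6" "\<not> p dvd 432" using not_dvd[of 1 1] not_dvd[of 4 3] by simp_all
      show "(of_nat k + 1) ^ 2 * c (Suc k) = (of_nat k ^ 2 + of_nat k + 5 / 36) * c k" for k
        by (rule choose_3_choose_6_recurrence[OF c_def])
      show "(of_nat r :: rat) < of_nat p / of_nat 6" using r by simp
    qed (simp_all add: c_def eval_nat_numeral)
    then show "Zp_cong p (p ^ 2)
        (\<Sum>k = 0..p - 1. of_nat ((3 * k) choose k) * of_nat ((6 * k) choose (3 * k)) / (432 ^ k * (of_nat k + b)))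
        ((- 1) ^ r * ((s + 1 / 6) * (s + 5 / 6) * of_nat p / (b ^ 2 * (s + 1) * of_nat ((2 * r) choose r)
          * of_nat ((p div 6 + r) choose (p div 6 - r)))))"
      unfolding w c_def divide_divide_eq_left .
  qed
qed

end
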